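(* Let $k>0$ be a constant, let $G$ be a context-free grammar in Chomsky form over a finite alphabet $\Sigma$ with polynomial ambiguity of degree $\Theta(n^k)$, i.e. $f_G(w)\le C|w|^k$ for all nonempty $w\in\Sigma^*$ and some constant $C>0$, let $A'$ be an HMM over $\Sigma$, and let $L\ge1$ be an integer. Consider the randomized algorithm POLYCFG-Likelihood described in the context, run on $(G,A',L,\epsilon)$. Then: 1. whenever the Bernoulli variable $X$ of the algorithm is defined (i.e. $\sum_{w\in\Sigma^L}f_G(w)f_{A'}(w)\neq0$), $\mathbb{P}(X=1)\ge\Omega\big(\tfrac{1}{L^k}\big)$, where the implied constant depends only on $C$; 2. for a suitable choice of the constant $c$ (depending only on $C$) in the sample size $N=\lceil c\,(L^k/\epsilon)^2\rceil$ of the algorithm, for every $\epsilon\in(0,1)$, with probability greater than $\tfrac34$, the output $\mathrm{OUT}$ of the algorithm on precision parameter $\epsilon$ satisfies $$(1-\epsilon)\, f_{A'}(L_G\cap\Sigma^L)\le \mathrm{OUT}\le(1+\epsilon)\, f_{A'}(L_G\cap\Sigma^L).$$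
   Context: CFG: a context-free grammar in Chomsky form has nonterminals $[n]=\{1,\dots,n\}$, terminal alphabet $\Sigma$, initial nonterminal $S\in[n]$, and a finite set of production rules of the form $i\to jk$ or $i\to\sigma$ with $i,j,k\in[n]$, $\sigma\in\Sigma$. For $w\in\Sigma^*$, $f_G(w)$ is the number of derivation trees of $G$ with root labelled $S$ and yield $w$; $L_G=\{w:f_G(w)\ge1\}$. HMM: $A'=\langle[n'],\pi',\{A'_\sigma\}_{\sigma\in\Sigma}\rangle$ with $\pi'$ a probability distribution over $[n']$ and entrywise non-negative matrices $A'_\sigma\in\mathbb{R}^{n'\times n'}$ such that $\sum_\sigma A'_\sigma$ has all row sums equal to $1$. For $w=w_1\cdots w_m$ (letters), $f_{A'}(w)=\pi'^TA'_{w_1}\cdots A'_{w_m}e_{[n']}$, where $e_{[n']}$ is the all-ones vector. For $X\subseteq\Sigma^*$, $f_{A'}(X)=\sum_{w\in X}f_{A'}(w)$. Algorithm POLYCFG-Likelihood. Input: $G$, $A'$, $L$, $\epsilon\in(0,1)$. (i) Compute $\tilde Z=\sum_{w\in\Sigma^L}f_G(w)f_{A'}(w)$ exactly. If $\tilde Z=0$, output $0$. (ii) Otherwise set $N=\lceil c\,(L^k/\epsilon)^2\rceil$, where $c>0$ is a constant, and $\tilde p=0$. Repeat $N$ times independently: draw $w\in\Sigma^L$ with probability $f_G(w)f_{A'}(w)/\tilde Z$; compute $f_G(w)$; draw $X\sim\mathrm{Bernoulli}(1/f_G(w))$ (conditionally on $w$); if $X=1$, increase $\tilde p$ by $1$.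 (iii) Output $\mathrm{OUT}=\tilde p\cdot\tilde Z/N$. *)

theory Defs
  imports "HOL-Probability.Probability" "Jordan_Normal_Form.Matrix"
begin

section \<open>Context-free grammars in Chomsky form\<close>

datatype 'a production = Binary nat nat nat | Terminal nat 'a

record 'a cnf_grammar =
  num_nonterms :: nat
  start :: nat
  rules :: "'a production set"

definition is_cnf_grammar :: "'a set \<Rightarrow> 'a cnf_grammar \<Rightarrow> bool" where
  "is_cnf_grammar \<Sigma> G \<longleftrightarrow>
     start G \<in> {1..num_nonterms G} \<and>
     finite (rules G) \<and>
     (\<forall>i j k. Binary i j k \<in> rules G \<longrightarrow> {i, j, k} \<subseteq> {1..num_nonterms G}) \<and>
     (\<forall>i \<sigma>. Terminal i \<sigma> \<in> rules G \<longrightarrow> i \<in> {1..num_nonterms G} \<and> \<sigma> \<in> \<Sigma>)"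

datatype 'a dtree = Leaf nat 'a | Branch nat "'a dtree" "'a dtree"

primrec root_label :: "'a dtree \<Rightarrow> nat" where
  "root_label (Leaf i \<sigma>) = i"
| "root_label (Branch i l r) = i"

primrec yield :: "'a dtree \<Rightarrow> 'a list" where
  "yield (Leaf i \<sigma>) = [\<sigma>]"
| "yield (Branch i l r) = yield l @ yield r"

primrec derivation_tree :: "'a cnf_grammar \<Rightarrow> 'a dtree \<Rightarrow> bool" where
  "derivation_tree G (Leaf i \<sigma>) \<longleftrightarrow> Terminal i \<sigma> \<in> rules G"
| "derivation_tree G (Branch i l r) \<longleftrightarrow>
     Binary i (root_label l) (root_label r) \<in> rules G \<and> derivation_tree G l \<and> derivation_tree G r"

definition trees_for :: "'a cnf_grammar \<Rightarrow> 'a list \<Rightarrow> 'a dtree set" where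
  "trees_for G w = {t. derivation_tree G t \<and> root_label t = start G \<and> yield t = w}"

definition ambiguity :: "'a cnf_grammar \<Rightarrow> 'a list \<Rightarrow> nat" where
  "ambiguity G w = card (trees_for G w)"

definition language :: "'a cnf_grammar \<Rightarrow> 'a list set" where
  "language G = {w. ambiguity G w \<ge> 1}"

lemma yield_not_Nil: "yield t \<noteq> []"
  by (induction t) auto

text \<open>The cardinality in \<^const>\<open>ambiguity\<close> is that of a finite set.\<close>

lemma finite_derivation_trees:
  assumes "finite (rules G)"
  shows "finite {t. derivation_tree G t \<and> yield t = w}"
proof (induction w rule: length_induct)
  case (1 w)
  define T where "T = (\<lambda>u. {t. derivation_tree G t \<and> yield t = u})"
  define B where "B = (\<Union>m\<in>{1..<length w}.
    (\<lambda>(p, l, r). case p of Binary i _ _ \<Rightarrow> Branch i l r | Terminal i \<sigma> \<Rightarrow> Leaf i \<sigma>)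
      ` (rules G \<times> T (take m w) \<times> T (drop m w)))"
  define A where "A = (\<lambda>p. case p of Binary i _ _ \<Rightarrow> undefined | Terminal i \<sigma> \<Rightarrow> Leaf i \<sigma>) ` rules G"
  have "finite (T (take m w))" "finite (T (drop m w))" if "m \<in> {1..<length w}" for m
    using 1 that unfolding T_def by auto
  then have "finite (A \<union> B)"
    using assms unfolding A_def B_def by auto
  moreover have "t \<in> A \<union> B" if "t \<in> T w" for t
  proof (cases t)
    case (Leaf i \<sigma>)
    then have "t \<in> A"
      using that unfolding T_def A_def by (auto intro!: image_eqI[where x = "Terminal i \<sigma>"])
    then show ?thesis ..
  next
    case (Branch i l r)
    have w: "w = yield l @ yield r"
      and d: "Binary i (root_label l) (root_label r) \<in> rules G" "derivation_tree G l" "derivation_tree G r"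
      using that Branch unfolding T_def by auto
    have m: "length (yield l) \<in> {1..<length w}"
      using w yield_not_Nil[of l] yield_not_Nil[of r] by (auto simp: Suc_le_eq)
    have "t \<in> (\<lambda>(p, l, r). case p of Binary i _ _ \<Rightarrow> Branch i l r | Terminal i \<sigma> \<Rightarrow> Leaf i \<sigma>)
      ` (rules G \<times> T (take (length (yield l)) w) \<times> T (drop (length (yield l)) w))"
      by (rule image_eqI[where x = "(Binary i (root_label l) (root_label r), l, r)"])
        (use Branch d w in \<open>auto simp: T_def\<close>)
    with m show ?thesis unfolding B_def by blast
  qed
  ultimately show ?case
    unfolding T_def by (meson finite_subset subsetI)
qed

lemma finite_trees_for:
  assumes "is_cnf_grammar \<Sigma> G"
  shows "finite (trees_for G w)"
  by (rule finite_subset[OF _ finite_derivation_trees[of G w]])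
    (use assms in \<open>auto simp: trees_for_def is_cnf_grammar_def\<close>)

section \<open>Hidden Markov models\<close>

text \<open>States are numbered from \<open>0\<close>, following the indexing of \<^typ>\<open>real mat\<close>.\<close>

record 'a hmm =
  num_states :: nat
  init_dist :: "real Matrix.vec"
  trans_mat :: "'a \<Rightarrow> real Matrix.mat"

definition is_hmm :: "'a set \<Rightarrow> 'a hmm \<Rightarrow> bool" where
  "is_hmm \<Sigma> A \<longleftrightarrow>
     init_dist A \<in> carrier_vec (num_states A) \<and>
     (\<forall>i<num_states A. vec_index (init_dist A) i \<ge> 0) \<and>
     (\<Sum>i<num_states A. vec_index (init_dist A) i) = 1 \<and>
     (\<forall>\<sigma>\<in>\<Sigma>. trans_mat A \<sigma> \<in> carrier_mat (num_states A) (num_states A) \<and>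
        (\<forall>i<num_states A. \<forall>j<num_states A. trans_mat A \<sigma> $$ (i, j) \<ge> 0)) \<and>
     (\<forall>i<num_states A. (\<Sum>j<num_states A. \<Sum>\<sigma>\<in>\<Sigma>. trans_mat A \<sigma> $$ (i, j)) = 1)"

definition word_mat :: "'a hmm \<Rightarrow> 'a list \<Rightarrow> real Matrix.mat" where
  "word_mat A w = foldr (\<lambda>\<sigma> M. trans_mat A \<sigma> * M) w (1\<^sub>m (num_states A))"

definition hmm_weight :: "'a hmm \<Rightarrow> 'a list \<Rightarrow> real" where
  "hmm_weight A w =
     scalar_prod (init_dist A) (word_mat A w *\<^sub>v Matrix.vec (num_states A) (\<lambda>_. 1))"

definition hmm_weight_set :: "'a hmm \<Rightarrow> 'a list set \<Rightarrow> real" where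
  "hmm_weight_set A X = infsum (hmm_weight A) X"

section \<open>The sampling algorithm\<close>

definition words :: "'a set \<Rightarrow> nat \<Rightarrow> 'a list set" where
  "words \<Sigma> L = {w. set w \<subseteq> \<Sigma> \<and> length w = L}"

definition Z_total :: "'a set \<Rightarrow> 'a cnf_grammar \<Rightarrow> 'a hmm \<Rightarrow> nat \<Rightarrow> real" where
  "Z_total \<Sigma> G A L = (\<Sum>w\<in>words \<Sigma> L. real (ambiguity G w) * hmm_weight A w)"

definition word_pmf :: "'a set \<Rightarrow> 'a cnf_grammar \<Rightarrow> 'a hmm \<Rightarrow> nat \<Rightarrow> 'a list pmf" where
  "word_pmf \<Sigma> G A L = embed_pmf (\<lambda>w.
     if w \<in> words \<Sigma> L then real (ambiguity G w) * hmm_weight A w / Z_total \<Sigma> G A L else 0)"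

text \<open>The law of the Bernoulli variable \<open>X\<close> of a single round (defined when
  \<^const>\<open>Z_total\<close> is nonzero).\<close>

definition trial_pmf :: "'a set \<Rightarrow> 'a cnf_grammar \<Rightarrow> 'a hmm \<Rightarrow> nat \<Rightarrow> bool pmf" where
  "trial_pmf \<Sigma> G A L =
     do { w \<leftarrow> word_pmf \<Sigma> G A L; bernoulli_pmf (1 / real (ambiguity G w)) }"

text \<open>\<open>c\<close> and \<open>k\<close> are constants of the algorithm; its input is \<open>G\<close>, \<open>A\<close>, \<open>L\<close>, \<open>\<epsilon>\<close>. Its value is the law of the
  random output.\<close>

definition sample_size :: "real \<Rightarrow> real \<Rightarrow> nat \<Rightarrow> real \<Rightarrow> nat" where
  "sample_size c k L \<epsilon> = nat \<lceil>c * (real L powr k / \<epsilon>)\<^sup>2\<rceil>"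

definition polycfg_likelihood ::
  "real \<Rightarrow> real \<Rightarrow> 'a set \<Rightarrow> 'a cnf_grammar \<Rightarrow> 'a hmm \<Rightarrow> nat \<Rightarrow> real \<Rightarrow> real pmf" where
  "polycfg_likelihood c k \<Sigma> G A L \<epsilon> =
     (if Z_total \<Sigma> G A L = 0 then return_pmf 0
      else
        let N = sample_size c k L \<epsilon> in
        do { xs \<leftarrow> replicate_pmf N (trial_pmf \<Sigma> G A L);
             let p = real (length (filter id xs));
             return_pmf (p * Z_total \<Sigma> G A L / real N) })"

lemma finite_words: "finite \<Sigma> \<Longrightarrow> finite (words \<Sigma> L)"
  unfolding words_def by (rule finite_lists_length_eq)

lemma word_mat_carrier_nonneg:
  assumes "is_hmm \<Sigma> A" "set w \<subseteq> \<Sigma>"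
  shows "word_mat A w \<in> carrier_mat (num_states A) (num_states A) \<and>
    (\<forall>i<num_states A. \<forall>j<num_states A. word_mat A w $$ (i, j) \<ge> 0)"
  using assms(2)
proof (induction w)
  case Nil
  then show ?case by (simp add: word_mat_def)
next
  case (Cons a w)
  have *: "word_mat A (a # w) = trans_mat A a * word_mat A w"
    by (simp add: word_mat_def)
  have a: "trans_mat A a \<in> carrier_mat (num_states A) (num_states A)"
    "\<forall>i<num_states A. \<forall>j<num_states A. trans_mat A a $$ (i, j) \<ge> 0"
    using assms(1) Cons.prems unfolding is_hmm_def by auto
  have w: "word_mat A w \<in> carrier_mat (num_states A) (num_states A)"
    "\<forall>i<num_states A. \<forall>j<num_states A. word_mat A w $$ (i, j) \<ge> 0"
    using Cons by auto
  show ?case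
    unfolding * using a w by (auto simp: scalar_prod_def intro!: sum_nonneg)
qed

lemma hmm_weight_nonneg:
  assumes "is_hmm \<Sigma> A" "set w \<subseteq> \<Sigma>"
  shows "hmm_weight A w \<ge> 0"
  using word_mat_carrier_nonneg[OF assms] assms(1)
  unfolding hmm_weight_def is_hmm_def
  by (auto simp: scalar_prod_def intro!: sum_nonneg mult_nonneg_nonneg)

lemma pmf_word_pmf:
  assumes "finite \<Sigma>" "is_hmm \<Sigma> A" "Z_total \<Sigma> G A L \<noteq> 0"
  shows "pmf (word_pmf \<Sigma> G A L) w =
    (if w \<in> words \<Sigma> L then real (ambiguity G w) * hmm_weight A w / Z_total \<Sigma> G A L else 0)"
proof -
  let ?f = "\<lambda>w. if w \<in> words \<Sigma> L then real (ambiguity G w) * hmm_weight A w / Z_total \<Sigma> G A L else 0"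
  have nn: "real (ambiguity G w) * hmm_weight A w \<ge> 0" if "w \<in> words \<Sigma> L" for w
    using that hmm_weight_nonneg[OF assms(2)] by (auto simp: words_def)
  then have Z: "Z_total \<Sigma> G A L \<ge> 0"
    unfolding Z_total_def by (rule sum_nonneg)
  have f: "?f w \<ge> 0" for w
    using nn Z by auto
  have "(\<integral>\<^sup>+ w. ennreal (?f w) \<partial>count_space UNIV) = (\<Sum>w\<in>words \<Sigma> L. ennreal (?f w))"
    by (rule nn_integral_count_space'[OF finite_words[OF assms(1)]]) auto
  also have "\<dots> = ennreal (\<Sum>w\<in>words \<Sigma> L. ?f w)"
    by (intro sum_ennreal f)
  also have "(\<Sum>w\<in>words \<Sigma> L. ?f w) = Z_total \<Sigma> G A L / Z_total \<Sigma> G A L"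
    by (simp add: sum_divide_distrib[symmetric] Z_total_def[symmetric] del: divide_self_if)
  also have "\<dots> = 1"
    using assms(3) by simp
  finally have "(\<integral>\<^sup>+ w. ennreal (?f w) \<partial>count_space UNIV) = 1"
    by simp
  then show ?thesis
    unfolding word_pmf_def by (rule pmf_embed_pmf[OF f])
qed

end

theory Submission
  imports Defs
begin

text \<open>Let \<open>F\<close> be the HMM weight of the words of length \<open>L\<close> in the language. Sampling a word in
  proportion to its ambiguity and then accepting it with the reciprocal probability cancels the
  ambiguity, so a trial succeeds with probability exactly \<open>p = F / Z\<close>; hence \<open>OUT / Z\<close> is the
  empirical mean of \<open>N\<close> independent Bernoulli variables with parameter \<open>p\<close>. The ambiguity bound
  gives \<open>Z \<le> C * L\<^sup>k * F\<close>, that is \<open>p \<ge> 1 / (C * L\<^sup>k)\<close>. A relative error \<open>\<epsilon>\<close> is an additive error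
  \<open>\<epsilon> * p\<close>, and Hoeffding's inequality bounds the failure probability by
  \<open>2 * exp (- 2 * N * \<epsilon>\<^sup>2 * p\<^sup>2) \<le> 2 * exp (- 2 * c / C\<^sup>2)\<close>.\<close>

text \<open>A law on \<open>bool\<close> is determined by its mass at \<open>True\<close>, so
  \<open>q\<close> is a Bernoulli law and the count of successes in \<open>n\<close> independent
  copies is binomial.\<close>

lemma map_pmf_count_replicate_pmf:
  "map_pmf (\<lambda>xs. length (filter id xs)) (replicate_pmf n q) = binomial_pmf n (pmf q True)"
proof -
  have "q = bernoulli_pmf (pmf q True)"
  proof (rule pmf_eqI)
    fix b
    have "pmf q True + pmf q False = 1"
      using sum_pmf_eq_1[OF finite subset_UNIV, of q] by (simp add: UNIV_bool add.commute)
    then show "pmf q b = pmf (bernoulli_pmf (pmf q True)) b"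
      by (cases b) (auto simp: pmf_le_1)
  qed
  then show ?thesis
    using binomial_pmf_altdef[of "pmf q True" n] by (simp add: pmf_le_1 comp_def)
qed

text \<open>Hoeffding's inequality for the empirical mean, taken with deviation
  \<open>\<epsilon> * p\<close>.\<close>

lemma binomial_relative_error_le:
  assumes "n > 0" "p \<in> {0..1}" "\<epsilon> \<ge> 0"
  shows "measure_pmf.prob (binomial_pmf n p) {x. \<bar>real x / real n - p\<bar> \<ge> \<epsilon> * p}
    \<le> 2 * exp (- 2 * (real n * (\<epsilon> * p)\<^sup>2))"
proof -
  interpret binomial_distribution n p
    using assms(2) by unfold_locales
  show ?thesis
    using prob_abs_ge'[OF assms(1), of "\<epsilon> * p"] assms by (simp add: mult.assoc)
qed

text \<open>Words outside the language have ambiguity 0 and contribute nothing. Used for both the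
  normalizer and the success probability of a trial.\<close>

lemma sum_words_eq_sum_language:
  assumes "finite \<Sigma>" "\<And>w. ambiguity G w = 0 \<Longrightarrow> f w = 0"
  shows "(\<Sum>w\<in>words \<Sigma> L. f w) = (\<Sum>w\<in>language G \<inter> words \<Sigma> L. f w)"
proof (intro sum.mono_neutral_right finite_words assms(1) ballI)
  fix w
  assume "w \<in> words \<Sigma> L - language G \<inter> words \<Sigma> L"
  then have "ambiguity G w = 0"
    by (auto simp: language_def)
  then show "f w = 0"
    by (rule assms(2))
qed simp

lemma hmm_weight_set_language_words:
  assumes "finite \<Sigma>"
  shows "hmm_weight_set A (language G \<inter> words \<Sigma> L) = (\<Sum>w\<in>language G \<inter> words \<Sigma> L. hmm_weight A w)"
  using finite_words[OF assms] by (simp add: hmm_weight_set_def)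

lemma Z_total_nonneg:
  assumes "is_hmm \<Sigma> A"
  shows "Z_total \<Sigma> G A L \<ge> 0"
  unfolding Z_total_def
  using hmm_weight_nonneg[OF assms] by (intro sum_nonneg mult_nonneg_nonneg) (auto simp: words_def)

text \<open>Passing to the language before bounding the ambiguity by \<open>B\<close> leaves the
  weight of the language, not of all words, on the right.\<close>

lemma Z_total_le:
  assumes "finite \<Sigma>" "is_hmm \<Sigma> A" "\<And>w. w \<in> words \<Sigma> L \<Longrightarrow> real (ambiguity G w) \<le> B"
  shows "Z_total \<Sigma> G A L \<le> B * hmm_weight_set A (language G \<inter> words \<Sigma> L)"
proof -
  have "Z_total \<Sigma> G A L =
      (\<Sum>w\<in>language G \<inter> words \<Sigma> L. real (ambiguity G w) * hmm_weight A w)"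
    unfolding Z_total_def by (rule sum_words_eq_sum_language) (use assms(1) in auto)
  also have "\<dots> \<le> (\<Sum>w\<in>language G \<inter> words \<Sigma> L. B * hmm_weight A w)"
    using hmm_weight_nonneg[OF assms(2)] assms(3)
    by (intro sum_mono mult_right_mono) (auto simp: words_def)
  finally show ?thesis
    by (simp add: hmm_weight_set_language_words[OF assms(1)] sum_distrib_left)
qed

lemma hmm_weight_set_language_eq_0:
  assumes "finite \<Sigma>" "is_hmm \<Sigma> A" "Z_total \<Sigma> G A L = 0"
  shows "hmm_weight_set A (language G \<inter> words \<Sigma> L) = 0"
proof -
  have "\<forall>w\<in>words \<Sigma> L. real (ambiguity G w) * hmm_weight A w = 0"
  proof (rule sum_nonneg_eq_0_iff[THEN iffD1])
    show "(\<Sum>w\<in>words \<Sigma> L. real (ambiguity G w) * hmm_weight A w) = 0"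
      using assms(3) by (simp add: Z_total_def)
  qed (use finite_words[OF assms(1)] hmm_weight_nonneg[OF assms(2)] in \<open>auto simp: words_def\<close>)
  then show ?thesis
    unfolding hmm_weight_set_language_words[OF assms(1)]
    by (intro sum.neutral) (auto simp: language_def)
qed

lemma pmf_trial_pmf_True:
  assumes "finite \<Sigma>" "is_hmm \<Sigma> A" "Z_total \<Sigma> G A L \<noteq> 0"
  shows "pmf (trial_pmf \<Sigma> G A L) True =
    hmm_weight_set A (language G \<inter> words \<Sigma> L) / Z_total \<Sigma> G A L"
proof -
  let ?Z = "Z_total \<Sigma> G A L"
  \<comment> \<open>Since \<open>1 / 0 = 0\<close>, the Bernoulli parameter lies in the unit
    interval even for words of ambiguity 0.\<close>
  have "pmf (trial_pmf \<Sigma> G A L) True =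
      measure_pmf.expectation (word_pmf \<Sigma> G A L) (\<lambda>w. 1 / real (ambiguity G w))"
    unfolding trial_pmf_def pmf_bind
    by (intro Bochner_Integration.integral_cong refl pmf_bernoulli_True) (auto simp: divide_le_eq_1)
  also have "\<dots> = (\<Sum>w\<in>words \<Sigma> L. 1 / real (ambiguity G w) * pmf (word_pmf \<Sigma> G A L) w)"
    by (rule integral_measure_pmf_real)
      (auto simp: set_pmf_iff pmf_word_pmf[OF assms] finite_words[OF assms(1)] split: if_splits)
  \<comment> \<open>The ambiguity cancels only where it is nonzero; the conditional records the
    value 0 elsewhere, which lets the sum be restricted to the language.\<close>
  also have "\<dots> = (\<Sum>w\<in>words \<Sigma> L. if ambiguity G w = 0 then 0 else hmm_weight A w / ?Z)"
    by (intro sum.cong) (auto simp: pmf_word_pmf[OF assms])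
  also have "\<dots> = (\<Sum>w\<in>language G \<inter> words \<Sigma> L. if ambiguity G w = 0 then 0 else hmm_weight A w / ?Z)"
    by (rule sum_words_eq_sum_language) (use assms(1) in auto)
  also have "\<dots> = (\<Sum>w\<in>language G \<inter> words \<Sigma> L. hmm_weight A w / ?Z)"
    by (intro sum.cong) (auto simp: language_def)
  finally show ?thesis
    by (simp add: hmm_weight_set_language_words[OF assms(1)] sum_divide_distrib)
qed

lemma polycfg_likelihood_eq_binomial:
  assumes "Z_total \<Sigma> G A L \<noteq> 0"
  shows "polycfg_likelihood c k \<Sigma> G A L \<epsilon> =
    map_pmf (\<lambda>x. real x * Z_total \<Sigma> G A L / real (sample_size c k L \<epsilon>))
      (binomial_pmf (sample_size c k L \<epsilon>) (pmf (trial_pmf \<Sigma> G A L) True))"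
  using assms
  by (simp add: polycfg_likelihood_def Let_def map_pmf_count_replicate_pmf[symmetric]
      pmf.map_comp comp_def map_pmf_def[symmetric])

lemma trial_pmf_True_ge:
  assumes "C > 0" "finite \<Sigma>" "is_hmm \<Sigma> A" "L \<ge> 1" "Z_total \<Sigma> G A L \<noteq> 0"
    and "\<And>w. w \<in> words \<Sigma> L \<Longrightarrow> real (ambiguity G w) \<le> C * real L powr k"
  shows "pmf (trial_pmf \<Sigma> G A L) True \<ge> 1 / (C * real L powr k)"
proof -
  have "Z_total \<Sigma> G A L > 0"
    using assms(5) Z_total_nonneg[OF assms(3), of G L] by simp
  moreover have "Z_total \<Sigma> G A L \<le> C * real L powr k * hmm_weight_set A (language G \<inter> words \<Sigma> L)"
    using assms by (intro Z_total_le) auto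
  ultimately show ?thesis
    using assms(1,4) unfolding pmf_trial_pmf_True[OF assms(2,3,5)]
    by (simp add: field_simps)
qed

text \<open>The factor \<open>C\<^sup>2\<close> in the sample size cancels the constant in the lower
  bound on \<open>p\<close>, and the powers of \<open>L\<close> and \<open>\<epsilon>\<close> cancel
  too; the 4 that remains is uniform in all parameters. Rounding up only helps.\<close>

lemma sample_size_exponent_ge:
  assumes "C > 0" "L \<ge> 1" "\<epsilon> > 0" "p \<ge> 1 / (C * real L powr k)"
  shows "real (sample_size (4 * C\<^sup>2) k L \<epsilon>) * (\<epsilon> * p)\<^sup>2 \<ge> 4"
proof -
  let ?y = "real L powr k"
  have y: "?y > 0"
    using assms(2) by simp
  have "\<epsilon> / (C * ?y) \<le> \<epsilon> * p"
    using mult_left_mono[OF assms(4), of \<epsilon>] assms(3) by simp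
  then have "(\<epsilon> / (C * ?y))\<^sup>2 \<le> (\<epsilon> * p)\<^sup>2"
    using assms(1,3) y by (intro power_mono) auto
  moreover have "real (sample_size (4 * C\<^sup>2) k L \<epsilon>) \<ge> 4 * C\<^sup>2 * (?y / \<epsilon>)\<^sup>2"
    unfolding sample_size_def by linarith
  ultimately have "4 * C\<^sup>2 * (?y / \<epsilon>)\<^sup>2 * (\<epsilon> / (C * ?y))\<^sup>2
      \<le> real (sample_size (4 * C\<^sup>2) k L \<epsilon>) * (\<epsilon> * p)\<^sup>2"
    by (intro mult_mono) auto
  moreover have "4 * C\<^sup>2 * (?y / \<epsilon>)\<^sup>2 * (\<epsilon> / (C * ?y))\<^sup>2 = 4"
    using assms(1,3) y by (simp add: power_divide power_mult_distrib)
  ultimately show ?thesis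
    by simp
qed

lemma polycfg_likelihood_accurate:
  assumes "C > 0" "finite \<Sigma>" "is_hmm \<Sigma> A" "L \<ge> 1" "\<epsilon> > 0"
    and amb: "\<And>w. w \<in> words \<Sigma> L \<Longrightarrow> real (ambiguity G w) \<le> C * real L powr k"
  defines "F \<equiv> hmm_weight_set A (language G \<inter> words \<Sigma> L)"
  shows "measure_pmf.prob (polycfg_likelihood (4 * C\<^sup>2) k \<Sigma> G A L \<epsilon>)
    {out. (1 - \<epsilon>) * F \<le> out \<and> out \<le> (1 + \<epsilon>) * F} > 3 / 4"
proof (cases "Z_total \<Sigma> G A L = 0")
  case True
  \<comment> \<open>The target interval collapses to the point 0, which is the certain
    output.\<close>
  then have "F = 0"
    unfolding F_def by (intro hmm_weight_set_language_eq_0 assms)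
  with True show ?thesis
    by (simp add: polycfg_likelihood_def)
next
  case False
  define Z where "Z = Z_total \<Sigma> G A L"
  define p where "p = pmf (trial_pmf \<Sigma> G A L) True"
  define n where "n = sample_size (4 * C\<^sup>2) k L \<epsilon>"
  let ?B = "binomial_pmf n p"
  let ?bad = "{x. \<bar>real x / real n - p\<bar> \<ge> \<epsilon> * p}"
  have Z: "Z > 0"
    using False Z_total_nonneg[OF assms(3), of G L] by (simp add: Z_def)
  have F: "F = p * Z"
    using Z pmf_trial_pmf_True[OF assms(2,3) False] by (simp add: p_def F_def Z_def)
  have exponent: "real n * (\<epsilon> * p)\<^sup>2 \<ge> 4"
    unfolding n_def p_def
    using assms(1-5) False amb by (intro sample_size_exponent_ge trial_pmf_True_ge)
  \<comment> \<open>With \<open>n = 0\<close> the product would be 0, below 4.\<close>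
  then have n: "n > 0"
    by (intro gr0I) simp
  have "measure_pmf.prob ?B ?bad \<le> 2 * exp (- 2 * (real n * (\<epsilon> * p)\<^sup>2))"
    using n assms(5) by (intro binomial_relative_error_le) (auto simp: p_def pmf_le_1)
  also have "\<dots> \<le> 2 * exp (- 8)"
    using exponent by simp
  \<comment> \<open>From \<open>exp 8 \<ge> 9\<close> the bound is at most 2/9.\<close>
  also have "\<dots> < 1 / 4"
    using exp_ge_add_one_self[of 8] by (simp add: exp_minus field_simps)
  finally have "3 / 4 < 1 - measure_pmf.prob ?B ?bad"
    by simp
  also have "\<dots> = measure_pmf.prob ?B (- ?bad)"
    using measure_pmf.prob_compl[of ?bad ?B] by (simp add: Compl_eq_Diff_UNIV)
  also have "\<dots> \<le> measure_pmf.prob ?B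
      {x. (1 - \<epsilon>) * F \<le> real x * Z / real n \<and> real x * Z / real n \<le> (1 + \<epsilon>) * F}"
  proof (rule measure_pmf.finite_measure_mono, rule subsetI)
    fix x
    assume "x \<in> - ?bad"
    then have "(1 - \<epsilon>) * p \<le> real x / real n" "real x / real n \<le> (1 + \<epsilon>) * p"
      by (auto simp: algebra_simps abs_if split: if_splits)
    \<comment> \<open>Scaling by \<open>Z > 0\<close> turns the relative error around
      \<open>p\<close> into the same relative error around \<open>F = p * Z\<close>.\<close>
    from this[THEN mult_right_mono, of Z]
    show "x \<in> {x. (1 - \<epsilon>) * F \<le> real x * Z / real n \<and> real x * Z / real n \<le> (1 + \<epsilon>) * F}"
      using Z by (simp add: F mult.assoc)
  qed simp
  finally show ?thesis
    by (simp add: polycfg_likelihood_eq_binomial[OF False] vimage_def n_def p_def Z_def)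
qed

theorem theorem5:
  fixes C :: real
  assumes "C > 0"
  shows "\<exists>\<delta>>0. \<exists>c>0. \<forall>(k::real) (\<Sigma>::'a set) (G::'a cnf_grammar) (A::'a hmm) (L::nat).
    k > 0 \<longrightarrow> finite \<Sigma> \<longrightarrow> is_cnf_grammar \<Sigma> G \<longrightarrow>
    (\<forall>w. w \<noteq> [] \<longrightarrow> set w \<subseteq> \<Sigma> \<longrightarrow> real (ambiguity G w) \<le> C * real (length w) powr k) \<longrightarrow>
    is_hmm \<Sigma> A \<longrightarrow> L \<ge> 1 \<longrightarrow>
    (Z_total \<Sigma> G A L \<noteq> 0 \<longrightarrow>
       pmf (trial_pmf \<Sigma> G A L) True \<ge> \<delta> * (1 / real L powr k)) \<and>
    (\<forall>\<epsilon>. 0 < \<epsilon> \<longrightarrow> \<epsilon> < 1 \<longrightarrow>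
       measure_pmf.prob (polycfg_likelihood c k \<Sigma> G A L \<epsilon>)
         {out. (1 - \<epsilon>) * hmm_weight_set A (language G \<inter> words \<Sigma> L) \<le> out \<and>
               out \<le> (1 + \<epsilon>) * hmm_weight_set A (language G \<inter> words \<Sigma> L)} > 3 / 4)"
proof (rule exI[of _ "1 / C"], rule conjI[OF _ exI[of _ "4 * C\<^sup>2"]], goal_cases)
  case 1
  show ?case
    using assms by simp
next
  case 2
  show ?case
  proof (intro conjI allI impI)
    fix k :: real and \<Sigma> :: "'a set" and G :: "'a cnf_grammar" and A :: "'a hmm" and L :: nat
    assume hyps: "finite \<Sigma>" "is_hmm \<Sigma> A" "L \<ge> 1"
      and poly: "\<forall>w. w \<noteq> [] \<longrightarrow> set w \<subseteq> \<Sigma> \<longrightarrow> real (ambiguity G w) \<le> C * real (length w) powr k"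
    \<comment> \<open>The growth bound covers nonempty words only; \<open>L \<ge> 1\<close> excludes
      the empty word.\<close>
    have amb: "real (ambiguity G w) \<le> C * real L powr k" if "w \<in> words \<Sigma> L" for w
      using poly[rule_format, of w] that hyps(3) by (cases "w = []") (auto simp: words_def)
    show "pmf (trial_pmf \<Sigma> G A L) True \<ge> 1 / C * (1 / real L powr k)" if "Z_total \<Sigma> G A L \<noteq> 0"
      using trial_pmf_True_ge[OF assms hyps that amb] by simp
    show "measure_pmf.prob (polycfg_likelihood (4 * C\<^sup>2) k \<Sigma> G A L \<epsilon>)
           {out. (1 - \<epsilon>) * hmm_weight_set A (language G \<inter> words \<Sigma> L) \<le> out \<and>
                 out \<le> (1 + \<epsilon>) * hmm_weight_set A (language G \<inter> words \<Sigma> L)} > 3 / 4"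
      if "0 < \<epsilon>" for \<epsilon>
      by (rule polycfg_likelihood_accurate[OF assms hyps that amb])
  qed (use assms in auto)
qed

end
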